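(* Let $f:H\to H'$ be a morphism between finite Heyting algebras (i.e. a morphism of the underlying distributive lattices). Then the functor $-\otimes_H H':Heymod_H\to Heymod_{H'}$ is left adjoint to the restriction functor $Res^{H'}_H:Heymod_{H'}\to Heymod_H$.
   Context: Lattices have all finite meets and joins (hence a least element $0$ and a greatest element $1$); lattice morphisms preserve finite meets and joins. A join semilattice is a poset in which every finite subset, including the empty one, has a join; its least element is $0$. For a distributive lattice $L$, a distributive module over $L$ is a join semilattice $M$ with an action $L\times M\to M$, $(x,m)\mapsto x\wedge m$, order preserving in both variables, such that $1\wedge m=m$, $0\wedge m=0$, $(x\wedge y)\wedge m=x\wedge(y\wedge m)$, $(x\vee y)\wedge m=(x\wedge m)\vee(y\wedge m)$, $x\wedge(m\vee n)=(x\wedge m)\vee(x\wedge n)$. Morphisms are maps preserving finite joins (including $0$) and satisfying $g(x\wedge m)=x\wedge g(m)$. A Heyting algebra $H$ is a lattice such that for all $y,z\in H$ there is $(y\to z)_H\in H$ with $x\wedge y\le z\Leftrightarrow x\le (y\to z)_H$ for all $x\in H$. A Heyting module over $H$ is a distributive module $M$ over $H$ such that for all $m,n\in M$ there is $(m\to n)_M\in H$ with $x\wedge m\le n\Leftrightarrow x\le(m\to n)_M$ for all $x\in H$; morphisms are morphisms of distributive modules. $Heymod_H$ is the resulting category. When $H$ is finite, every distributive module over $H$ is a Heyting module. Tensor product: for a set $S$, $Free_H(S)$ is the set of functions $S\to H$ of finite support with pointwise $\vee$ and pointwise action of $H$; its elements are written as formal finite sums (joins) $\sum c_i\wedge s_i$,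 $c_i\in H$, $s_i\in S$. For $M,N\in Heymod_H$, $M\otimes_H N$ is the quotient of $Free_H(M\times N)$ by the equivalence relation generated by the following, where $u=\sum c_i\wedge(m_i,n_i)$ is arbitrary, $c,d\in H$, $m,m'\in M$, $n,n'\in N$: $u+c\wedge(0,n)\sim u\sim u+c\wedge(m,0)$; $u+c\wedge(m,n)+c\wedge(m',n)\sim u+c\wedge(m\vee m',n)$; $u+c\wedge(m,n)+c\wedge(m,n')\sim u+c\wedge(m,n\vee n')$; $u+c\wedge(d\wedge m,n)\sim u+(c\wedge d)\wedge(m,n)\sim u+c\wedge(m,d\wedge n)$. It is a Heyting module over $H$ with the induced operations. Given $f:H\to H'$, the restriction $Res^{H'}_H(N')$ of $N'\in Heymod_{H'}$ is $N'$ with the $H$-action $(c,n)\mapsto f(c)\wedge n$. In particular $H'\in Heymod_H$, and for $M\in Heymod_H$ the module $M\otimes_H H'$ is regarded as an object of $Heymod_{H'}$ via $\left(\sum c_i\wedge(m_i,h_i')\right)\wedge h'=\sum c_i\wedge(m_i,h_i'\wedge h')$; this defines the functor $-\otimes_H H'$. *)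

theory Defs
  imports "HOL-Algebra.Lattice" "HOL-Library.FuncSet"
begin

(* From here on sup, inf, top are the operations of the lattice type classes; on functions they
   are pointwise. *)
hide_const (open) Lattice.sup Lattice.inf Order.top

section \<open>Heyting algebras\<close>

text \<open>The residual is only required to exist: it is not part of the signature, and morphisms need
  not preserve it.\<close>

class heyting_algebra = Lattices.bounded_lattice +
  assumes residual_exists: "\<exists>w. \<forall>x. inf x y \<le> z \<longleftrightarrow> x \<le> w"

subclass (in heyting_algebra) Lattices.distrib_lattice
proof
  have le: "inf x (sup y z) \<le> sup (inf x y) (inf x z)" for x y z :: 'a
    using residual_exists[of x "sup (inf x y) (inf x z)"]
    by (metis inf_commute le_sup_iff order_refl sup_ge1 sup_ge2)
  fix x y z :: 'a
  show "sup x (inf y z) = inf (sup x y) (sup x z)"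
  proof (rule order.antisym)
    have "inf (sup x y) (sup x z) \<le> sup (inf (sup x y) x) (inf (sup x y) z)" by (rule le)
    also have "\<dots> \<le> sup x (inf z (sup x y))" by (simp add: inf_commute le_supI1)
    also have "\<dots> \<le> sup x (sup (inf z x) (inf z y))" by (rule sup_mono[OF order_refl le])
    also have "\<dots> \<le> sup x (inf y z)"
      by (simp add: inf_commute) (metis inf_le1 inf_commute le_supI1)
    finally show "inf (sup x y) (sup x z) \<le> sup x (inf y z)" .
  qed (auto intro: le_infI1 le_infI2)
qed

definition lattice_morphism ::
    "('h::Lattices.bounded_lattice \<Rightarrow> 'k::Lattices.bounded_lattice) \<Rightarrow> bool" where
  "lattice_morphism f \<longleftrightarrow> f bot = bot \<and> f top = top \<and>
     (\<forall>x y. f (inf x y) = inf (f x) (f y)) \<and> (\<forall>x y. f (sup x y) = sup (f x) (f y))"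


section \<open>Distributive modules and Heyting modules\<close>

locale join_semilattice = partial_order +
  assumes finite_join_exists:
    "\<lbrakk>finite A; A \<subseteq> carrier L\<rbrakk> \<Longrightarrow> \<exists>s. least L s (Upper L A)"

sublocale join_semilattice \<subseteq> upper_semilattice
  by unfold_locales (simp add: finite_join_exists)

sublocale join_semilattice \<subseteq> weak_partial_order_bottom
  using finite_join_exists[of "{}"] by unfold_locales simp

record ('m, 'h) lmodule = "'m gorder" +
  act :: "'h \<Rightarrow> 'm \<Rightarrow> 'm"

locale distributive_module = join_semilattice M
  for M :: "('m, 'h::{Lattices.bounded_lattice, Lattices.distrib_lattice}) lmodule" (structure) +
  assumes act_closed: "m \<in> carrier M \<Longrightarrow> act M x m \<in> carrier M"
    and act_mono: "\<lbrakk>m \<in> carrier M; n \<in> carrier M; x \<le> y; m \<sqsubseteq> n\<rbrakk> \<Longrightarrow> act M x m \<sqsubseteq> act M y n"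
    and act_top: "m \<in> carrier M \<Longrightarrow> act M top m = m"
    and act_bot: "m \<in> carrier M \<Longrightarrow> act M bot m = \<bottom>"
    and act_inf: "m \<in> carrier M \<Longrightarrow> act M (inf x y) m = act M x (act M y m)"
    and act_sup: "m \<in> carrier M \<Longrightarrow> act M (sup x y) m = act M x m \<squnion> act M y m"
    and act_join: "\<lbrakk>m \<in> carrier M; n \<in> carrier M\<rbrakk>
      \<Longrightarrow> act M x (m \<squnion> n) = act M x m \<squnion> act M x n"

locale heyting_module = distributive_module M
  for M :: "('m, 'h::heyting_algebra) lmodule" (structure) +
  assumes module_residual_exists: "\<lbrakk>m \<in> carrier M; n \<in> carrier M\<rbrakk>
      \<Longrightarrow> \<exists>w. \<forall>x. act M x m \<sqsubseteq> n \<longleftrightarrow> x \<le> w"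

text \<open>Morphisms are extensional functions, so that equality of morphisms is equality of HOL
  functions. Composition is \<^const>\<open>compose\<close>.\<close>

definition module_hom ::
    "('m, 'h::{Lattices.bounded_lattice, Lattices.distrib_lattice}) lmodule \<Rightarrow>
     ('n, 'h) lmodule \<Rightarrow> ('m \<Rightarrow> 'n) set" where
  "module_hom M N = {g \<in> carrier M \<rightarrow>\<^sub>E carrier N.
     g \<bottom>\<^bsub>M\<^esub> = \<bottom>\<^bsub>N\<^esub> \<and>
     (\<forall>m\<in>carrier M. \<forall>n\<in>carrier M. g (m \<squnion>\<^bsub>M\<^esub> n) = g m \<squnion>\<^bsub>N\<^esub> g n) \<and>
     (\<forall>x. \<forall>m\<in>carrier M. g (act M x m) = act N x (g m))}"

definition module_id :: "('m, 'h) lmodule \<Rightarrow> 'm \<Rightarrow> 'm" where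
  "module_id M = (\<lambda>m\<in>carrier M. m)"


section \<open>Free modules and tensor products\<close>

text \<open>Functions on \<open>S\<close> are represented by functions on the whole type that vanish outside \<open>S\<close>.\<close>

definition free_module ::
    "'s set \<Rightarrow> ('s \<Rightarrow> 'h::{Lattices.bounded_lattice, Lattices.distrib_lattice}, 'h) lmodule" where
  "free_module S = \<lparr>carrier = {u. finite {s. u s \<noteq> bot} \<and> {s. u s \<noteq> bot} \<subseteq> S},
     eq = (=), le = (\<le>), act = (\<lambda>c u s. inf c (u s))\<rparr>"

definition free_gen :: "'h::Lattices.bounded_lattice \<Rightarrow> 's \<Rightarrow> 's \<Rightarrow> 'h" where
  "free_gen c s = (\<lambda>t. if t = s then c else bot)"

text \<open>The map of free modules induced by \<open>\<phi>\<close>, that is,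
  \<open>\<Sum> c\<^sub>i \<and> s\<^sub>i \<mapsto> \<Sum> c\<^sub>i \<and> \<phi>(s\<^sub>i)\<close>: the coefficient of \<open>t\<close> in the image is the join of the
  coefficients of all \<open>s\<close> with \<open>\<phi>(s) = t\<close>.\<close>

definition free_map ::
    "('s \<Rightarrow> 't) \<Rightarrow> ('s \<Rightarrow> 'h::Lattices.bounded_lattice) \<Rightarrow> 't \<Rightarrow> 'h" where
  "free_map \<phi> u = (\<lambda>t. Sup_fin (insert bot (u ` {s. u s \<noteq> bot \<and> \<phi> s = t})))"

inductive tensor_eq ::
    "('m, 'h::heyting_algebra) lmodule \<Rightarrow> ('n, 'h) lmodule \<Rightarrow>
     ('m \<times> 'n \<Rightarrow> 'h) \<Rightarrow> ('m \<times> 'n \<Rightarrow> 'h) \<Rightarrow> bool"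
  for M :: "('m, 'h) lmodule" and N :: "('n, 'h) lmodule" where
  zero_left: "\<lbrakk>u \<in> carrier (free_module (carrier M \<times> carrier N)); n \<in> carrier N\<rbrakk>
    \<Longrightarrow> tensor_eq M N (sup u (free_gen c (\<bottom>\<^bsub>M\<^esub>, n))) u"
| zero_right: "\<lbrakk>u \<in> carrier (free_module (carrier M \<times> carrier N)); m \<in> carrier M\<rbrakk>
    \<Longrightarrow> tensor_eq M N (sup u (free_gen c (m, \<bottom>\<^bsub>N\<^esub>))) u"
| join_left: "\<lbrakk>u \<in> carrier (free_module (carrier M \<times> carrier N));
      m \<in> carrier M; m' \<in> carrier M; n \<in> carrier N\<rbrakk>
    \<Longrightarrow> tensor_eq M N (sup (sup u (free_gen c (m, n))) (free_gen c (m', n)))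
                      (sup u (free_gen c (m \<squnion>\<^bsub>M\<^esub> m', n)))"
| join_right: "\<lbrakk>u \<in> carrier (free_module (carrier M \<times> carrier N));
      m \<in> carrier M; n \<in> carrier N; n' \<in> carrier N\<rbrakk>
    \<Longrightarrow> tensor_eq M N (sup (sup u (free_gen c (m, n))) (free_gen c (m, n')))
                      (sup u (free_gen c (m, n \<squnion>\<^bsub>N\<^esub> n')))"
| act_left: "\<lbrakk>u \<in> carrier (free_module (carrier M \<times> carrier N)); m \<in> carrier M; n \<in> carrier N\<rbrakk>
    \<Longrightarrow> tensor_eq M N (sup u (free_gen c (act M d m, n))) (sup u (free_gen (inf c d) (m, n)))"
| act_right: "\<lbrakk>u \<in> carrier (free_module (carrier M \<times> carrier N)); m \<in> carrier M; n \<in> carrier N\<rbrakk>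
    \<Longrightarrow> tensor_eq M N (sup u (free_gen (inf c d) (m, n))) (sup u (free_gen c (m, act N d n)))"
| refl: "u \<in> carrier (free_module (carrier M \<times> carrier N)) \<Longrightarrow> tensor_eq M N u u"
| sym: "tensor_eq M N u v \<Longrightarrow> tensor_eq M N v u"
| trans: "\<lbrakk>tensor_eq M N u v; tensor_eq M N v w\<rbrakk> \<Longrightarrow> tensor_eq M N u w"

definition tensor_class ::
    "('m, 'h::heyting_algebra) lmodule \<Rightarrow> ('n, 'h) lmodule \<Rightarrow>
     ('m \<times> 'n \<Rightarrow> 'h) \<Rightarrow> ('m \<times> 'n \<Rightarrow> 'h) set" where
  "tensor_class M N u = {v. tensor_eq M N u v}"

text \<open>An operation on the tensor product induced by an operation on representatives is the union
  of all classes so obtained. The order is the one for which the induced operation is the binary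
  join.\<close>

definition tensor_join ::
    "('m, 'h::heyting_algebra) lmodule \<Rightarrow> ('n, 'h) lmodule \<Rightarrow>
     ('m \<times> 'n \<Rightarrow> 'h) set \<Rightarrow> ('m \<times> 'n \<Rightarrow> 'h) set \<Rightarrow> ('m \<times> 'n \<Rightarrow> 'h) set" where
  "tensor_join M N X Y = (\<Union>u\<in>X. \<Union>v\<in>Y. tensor_class M N (sup u v))"

definition tensor ::
    "('m, 'h::heyting_algebra) lmodule \<Rightarrow> ('n, 'h) lmodule \<Rightarrow>
     (('m \<times> 'n \<Rightarrow> 'h) set, 'h) lmodule" where
  "tensor M N = (let F = free_module (carrier M \<times> carrier N) in
     \<lparr>carrier = tensor_class M N ` carrier F,
      eq = (=),
      le = (\<lambda>X Y. tensor_join M N X Y = Y),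
      act = (\<lambda>c X. \<Union>u\<in>X. tensor_class M N (act F c u))\<rparr>)"


section \<open>Restriction and extension of scalars\<close>

definition lattice_module ::
    "('k::{Lattices.bounded_lattice, Lattices.distrib_lattice}, 'k) lmodule" where
  "lattice_module = \<lparr>carrier = UNIV, eq = (=), le = (\<le>), act = inf\<rparr>"

text \<open>On morphisms, restriction of scalars is the identity.\<close>

definition restrict_scalars :: "('h \<Rightarrow> 'k) \<Rightarrow> ('n, 'k) lmodule \<Rightarrow> ('n, 'h) lmodule" where
  "restrict_scalars f N =
     \<lparr>carrier = carrier N, eq = eq N, le = le N, act = (\<lambda>c. act N (f c))\<rparr>"

definition restrict_scalars_map ::
    "('n, 'k) lmodule \<Rightarrow> ('n, 'k) lmodule \<Rightarrow> ('n \<Rightarrow> 'n) \<Rightarrow> 'n \<Rightarrow> 'n" where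
  "restrict_scalars_map N N' g = g"

definition extend_scalars ::
    "('h::heyting_algebra \<Rightarrow> 'k::heyting_algebra) \<Rightarrow> ('m, 'h) lmodule \<Rightarrow>
     (('m \<times> 'k \<Rightarrow> 'h) set, 'k) lmodule" where
  "extend_scalars f M = (let H' = restrict_scalars f lattice_module; T = tensor M H' in
     \<lparr>carrier = carrier T, eq = eq T, le = le T,
      act = (\<lambda>h' X. \<Union>u\<in>X. tensor_class M H' (free_map (\<lambda>(m, h). (m, inf h h')) u))\<rparr>)"

text \<open>On morphisms, extension of scalars is \<open>g \<otimes> id\<close>, that is,
  \<open>\<Sum> c\<^sub>i \<and> (m\<^sub>i, h\<^sub>i) \<mapsto> \<Sum> c\<^sub>i \<and> (g(m\<^sub>i), h\<^sub>i)\<close>.\<close>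

definition extend_scalars_map ::
    "('h::heyting_algebra \<Rightarrow> 'k::heyting_algebra) \<Rightarrow> ('m, 'h) lmodule \<Rightarrow> ('m, 'h) lmodule \<Rightarrow>
     ('m \<Rightarrow> 'm) \<Rightarrow> ('m \<times> 'k \<Rightarrow> 'h) set \<Rightarrow> ('m \<times> 'k \<Rightarrow> 'h) set" where
  "extend_scalars_map f M M' g = (\<lambda>X\<in>carrier (extend_scalars f M).
     \<Union>u\<in>X. tensor_class M' (restrict_scalars f lattice_module) (free_map (\<lambda>(m, h). (g m, h)) u))"


section \<open>Functors and adjunctions between categories of Heyting modules\<close>

text \<open>The carriers of the objects of a category of Heyting modules are subsets of a type, which
  plays the role of the universe. Since the carrier of a tensor product lives in another type than
  the carriers of its factors, functors may change the universe.\<close>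

definition heymod_functor ::
    "(('m, 'h::heyting_algebra) lmodule \<Rightarrow> ('n, 'k::heyting_algebra) lmodule) \<Rightarrow>
     (('m, 'h) lmodule \<Rightarrow> ('m, 'h) lmodule \<Rightarrow> ('m \<Rightarrow> 'm) \<Rightarrow> 'n \<Rightarrow> 'n) \<Rightarrow> bool" where
  "heymod_functor F F\<^sub>1 \<longleftrightarrow>
     (\<forall>M. heyting_module M \<longrightarrow> heyting_module (F M) \<and> F\<^sub>1 M M (module_id M) = module_id (F M)) \<and>
     (\<forall>M N g. heyting_module M \<and> heyting_module N \<and> g \<in> module_hom M N \<longrightarrow>
        F\<^sub>1 M N g \<in> module_hom (F M) (F N)) \<and>
     (\<forall>M N P g h. heyting_module M \<and> heyting_module N \<and> heyting_module P \<and>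
        g \<in> module_hom M N \<and> h \<in> module_hom N P \<longrightarrow>
        F\<^sub>1 M P (compose (carrier M) h g) = compose (carrier (F M)) (F\<^sub>1 N P h) (F\<^sub>1 M N g))"

text \<open>\<open>F\<close> is left adjoint to \<open>G\<close> if there are bijections \<open>Hom(F M, N) \<cong> Hom(M, G N)\<close>, natural in
  \<open>M\<close> and in \<open>N\<close>. Here \<open>M\<close> and \<open>N\<close> range over independent universes \<open>'m\<close> and \<open>'n\<close>.\<close>

definition heymod_left_adjoint ::
    "(('m, 'h::heyting_algebra) lmodule \<Rightarrow> ('t, 'k::heyting_algebra) lmodule) \<Rightarrow>
     (('m, 'h) lmodule \<Rightarrow> ('m, 'h) lmodule \<Rightarrow> ('m \<Rightarrow> 'm) \<Rightarrow> 't \<Rightarrow> 't) \<Rightarrow>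
     (('n, 'k) lmodule \<Rightarrow> ('s, 'h) lmodule) \<Rightarrow>
     (('n, 'k) lmodule \<Rightarrow> ('n, 'k) lmodule \<Rightarrow> ('n \<Rightarrow> 'n) \<Rightarrow> 's \<Rightarrow> 's) \<Rightarrow> bool" where
  "heymod_left_adjoint F F\<^sub>1 G G\<^sub>1 \<longleftrightarrow> heymod_functor F F\<^sub>1 \<and> heymod_functor G G\<^sub>1 \<and>
     (\<exists>\<Phi> :: ('m, 'h) lmodule \<Rightarrow> ('n, 'k) lmodule \<Rightarrow> ('t \<Rightarrow> 'n) \<Rightarrow> 'm \<Rightarrow> 's.
        (\<forall>M N. heyting_module M \<and> heyting_module N \<longrightarrow>
           bij_betw (\<Phi> M N) (module_hom (F M) N) (module_hom M (G N))) \<and>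
        (\<forall>M M' N N' g k \<phi>. heyting_module M \<and> heyting_module M' \<and>
           heyting_module N \<and> heyting_module N' \<and>
           g \<in> module_hom M' M \<and> k \<in> module_hom N N' \<and> \<phi> \<in> module_hom (F M) N \<longrightarrow>
           \<Phi> M' N' (compose (carrier (F M')) k (compose (carrier (F M')) \<phi> (F\<^sub>1 M' M g))) =
             compose (carrier M') (G\<^sub>1 N N' k) (compose (carrier M') (\<Phi> M N \<phi>) g)))"

end

theory Submission
  imports Defs
begin

text \<open>Since \<open>c \<and> (m, h) = (f(c) \<and> h) \<and> (1 \<and> (m, 1))\<close> in \<open>M \<otimes> H'\<close>, the image of the unit
  \<open>m \<mapsto> 1 \<and> (m, 1)\<close> generates \<open>M \<otimes> H'\<close> as a module over \<open>H'\<close>, so a morphism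
  \<open>M \<otimes> H' \<rightarrow> N\<close> is determined by its composite with the unit. Conversely a morphism
  \<open>\<psi>: M \<rightarrow> Res N\<close> extends by \<open>\<Sum> c\<^sub>i \<and> (m\<^sub>i, h\<^sub>i) \<mapsto> \<Or> (f(c\<^sub>i) \<and> h\<^sub>i) \<and> \<psi>(m\<^sub>i)\<close>, which
  respects the generating relations of the tensor product. Hence composition with the unit is
  bijective on morphisms. Finiteness of \<open>H\<close> and \<open>H'\<close> supplies the residuals.\<close>

section \<open>Distributive modules\<close>

context join_semilattice
begin

text \<open>The supremum is a Hilbert choice, so it has its defining property once some least upper
  bound exists, which the locale grants for finite sets.\<close>

lemma finite_Sup_least: "\<lbrakk>finite A; A \<subseteq> carrier L\<rbrakk> \<Longrightarrow> least L (\<Squnion>A) (Upper L A)"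
  unfolding Lattice.sup_def using finite_join_exists by (rule someI_ex)

lemma finite_Sup_le_iff:
  assumes "finite A" "A \<subseteq> carrier L" "y \<in> carrier L"
  shows "\<Squnion>A \<sqsubseteq> y \<longleftrightarrow> (\<forall>a\<in>A. a \<sqsubseteq> y)"
proof -
  have l: "least L (\<Squnion>A) (Upper L A)" using assms by (intro finite_Sup_least)
  show ?thesis
  proof
    assume "\<Squnion>A \<sqsubseteq> y"
    with l assms show "\<forall>a\<in>A. a \<sqsubseteq> y"
      by (metis le_trans least_Upper_above least_closed subsetD)
  next
    assume "\<forall>a\<in>A. a \<sqsubseteq> y"
    with assms show "\<Squnion>A \<sqsubseteq> y" by (intro least_le[OF l] Upper_memI) auto
  qed
qed

lemma join_le_iff:
  assumes "x \<in> carrier L" "y \<in> carrier L" "z \<in> carrier L"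
  shows "x \<squnion> y \<sqsubseteq> z \<longleftrightarrow> x \<sqsubseteq> z \<and> y \<sqsubseteq> z"
  using assms by (simp add: join_def finite_Sup_le_iff)

text \<open>Antisymmetry in a form that, together with \<open>join_le_iff\<close>, turns identities
  between joins into propositional equivalences.\<close>

lemma eqI_upper:
  assumes "x \<in> carrier L" "y \<in> carrier L" "\<And>z. z \<in> carrier L \<Longrightarrow> x \<sqsubseteq> z \<longleftrightarrow> y \<sqsubseteq> z"
  shows "x = y"
  using assms by (meson le_antisym local.le_refl)

lemma bottom_join [simp]: "x \<in> carrier L \<Longrightarrow> \<bottom> \<squnion> x = x"
  by (rule eqI_upper) (auto simp: join_le_iff intro: le_trans)

lemma join_bottom [simp]: "x \<in> carrier L \<Longrightarrow> x \<squnion> \<bottom> = x"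
  by (rule eqI_upper) (auto simp: join_le_iff intro: le_trans)

lemma join_idem [simp]: "x \<in> carrier L \<Longrightarrow> x \<squnion> x = x"
  by (rule eqI_upper) (auto simp: join_le_iff)

lemma join_assoc:
  "\<lbrakk>x \<in> carrier L; y \<in> carrier L; z \<in> carrier L\<rbrakk> \<Longrightarrow> x \<squnion> y \<squnion> z = x \<squnion> (y \<squnion> z)"
  by (rule eqI_upper) (auto simp: join_le_iff)

lemma le_iff_join:
  assumes "x \<in> carrier L" "y \<in> carrier L" shows "x \<sqsubseteq> y \<longleftrightarrow> x \<squnion> y = y"
proof
  assume "x \<sqsubseteq> y"
  then show "x \<squnion> y = y" using assms by (intro le_antisym) (auto simp: join_le_iff join_right)
qed (use assms join_left[of x y] in simp)

end

text \<open>The locale \<^locale>\<open>distributive_module\<close> takes the order as primitive and obtains the joins by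
  choice; here the join operation is given and determines the order.\<close>

lemma
  fixes M :: "('m, 'h::{Lattices.bounded_lattice, Lattices.distrib_lattice}) lmodule" (structure)
    and j :: "'m \<Rightarrow> 'm \<Rightarrow> 'm" and z :: 'm
  assumes eq: "eq M = (=)"
    and le: "\<And>x y. \<lbrakk>x \<in> carrier M; y \<in> carrier M\<rbrakk> \<Longrightarrow> x \<sqsubseteq> y \<longleftrightarrow> j x y = y"
    and z: "z \<in> carrier M" "\<And>x. x \<in> carrier M \<Longrightarrow> j z x = x"
    and j: "\<And>x y. \<lbrakk>x \<in> carrier M; y \<in> carrier M\<rbrakk> \<Longrightarrow> j x y \<in> carrier M"
      "\<And>x. x \<in> carrier M \<Longrightarrow> j x x = x"
      "\<And>x y. \<lbrakk>x \<in> carrier M; y \<in> carrier M\<rbrakk> \<Longrightarrow> j x y = j y x"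
      "\<And>w x y. \<lbrakk>w \<in> carrier M; x \<in> carrier M; y \<in> carrier M\<rbrakk> \<Longrightarrow> j (j w x) y = j w (j x y)"
    and act: "\<And>c m. m \<in> carrier M \<Longrightarrow> act M c m \<in> carrier M"
      "\<And>m. m \<in> carrier M \<Longrightarrow> act M top m = m"
      "\<And>m. m \<in> carrier M \<Longrightarrow> act M bot m = z"
      "\<And>c d m. m \<in> carrier M \<Longrightarrow> act M (inf c d) m = act M c (act M d m)"
      "\<And>c d m. m \<in> carrier M \<Longrightarrow> act M (sup c d) m = j (act M c m) (act M d m)"
      "\<And>c m n. \<lbrakk>m \<in> carrier M; n \<in> carrier M\<rbrakk> \<Longrightarrow> act M c (j m n) = j (act M c m) (act M c n)"
  shows distributive_moduleI: "distributive_module M"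
    and bottom_eqI: "\<bottom> = z"
    and join_eqI: "\<lbrakk>x \<in> carrier M; y \<in> carrier M\<rbrakk> \<Longrightarrow> x \<squnion> y = j x y"
proof -
  have po: "partial_order M"
  proof
    \<comment> \<open>Transitivity is associativity:
      \<open>j x w = j x (j y w) = j (j x y) w = j y w = w\<close>.\<close>
    fix x y w assume "x \<sqsubseteq> y" "y \<sqsubseteq> w" "x \<in> carrier M" "y \<in> carrier M" "w \<in> carrier M"
    then show "x \<sqsubseteq> w" using j(4)[of x y w] by (simp add: le)
  next
    fix x y assume "x \<sqsubseteq> y" "y \<sqsubseteq> x" "x \<in> carrier M" "y \<in> carrier M"
    then show "x .= y" using j(3)[of x y] by (simp add: le eq)
  qed (auto simp: eq le j(2))
  interpret partial_order M by (rule po)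
  have j_upper: "x \<sqsubseteq> j x y" "y \<sqsubseteq> j x y" if c: "x \<in> carrier M" "y \<in> carrier M" for x y
  proof -
    have "j x (j x y) = j x y" using c j(2)[of x] j(4)[of x x y] by simp
    then show "x \<sqsubseteq> j x y" using c by (simp add: le j(1))
    have "j y (j x y) = j (j x y) y" using c j(1) by (intro j(3)) auto
    also have "\<dots> = j x y" using c j(2)[of y] j(4)[of x y y] by simp
    finally show "y \<sqsubseteq> j x y" using c by (simp add: le j(1))
  qed
  have j_le: "j x y \<sqsubseteq> w \<longleftrightarrow> x \<sqsubseteq> w \<and> y \<sqsubseteq> w"
    if c: "x \<in> carrier M" "y \<in> carrier M" "w \<in> carrier M" for x y w
  proof -
    have "j x y \<sqsubseteq> w" if "x \<sqsubseteq> w" "y \<sqsubseteq> w" using that c j(4)[of x y w] by (simp add: le j(1))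
    with j_upper[OF c(1,2)] j(1)[OF c(1,2)] c show ?thesis by (blast intro: le_trans)
  qed
  \<comment> \<open>A least upper bound of a finite set arises by folding \<open>j\<close> over its
    elements, starting from \<open>z\<close> for the empty set.\<close>
  have fin: "\<exists>s. least M s (Upper M A)" if "finite A" "A \<subseteq> carrier M" for A
    using that
  proof (induction A)
    case empty
    have "least M z (Upper M {})" by (simp add: least_def z le)
    then show ?case ..
  next
    case (insert a A)
    then obtain s where s: "least M s (Upper M A)" by auto
    then have sc: "s \<in> carrier M" by (rule least_closed)
    have ac: "a \<in> carrier M" and Ac: "A \<subseteq> carrier M" using insert.prems by auto
    have "least M (j a s) (Upper M (insert a A))"
    proof (rule least_UpperI)
      have js: "a \<sqsubseteq> j a s" "s \<sqsubseteq> j a s" by (rule j_upper[OF ac sc])+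
      fix x assume "x \<in> insert a A"
      then consider "x = a" | "x \<in> A" by blast
      then show "x \<sqsubseteq> j a s"
      proof cases
        case 2
        with Ac have "x \<sqsubseteq> s" "x \<in> carrier M" using least_Upper_above[OF s] by auto
        then show ?thesis using js(2) sc j(1)[OF ac sc] by (rule_tac le_trans)
      qed (simp add: js)
    next
      fix y assume y: "y \<in> Upper M (insert a A)"
      then have yc: "y \<in> carrier M" by (meson Upper_closed subsetD)
      have "s \<sqsubseteq> y" using y by (intro least_le[OF s]) (meson Upper_antimono subsetD subset_insertI)
      moreover have "a \<sqsubseteq> y" using y insert.prems by blast
      ultimately show "j a s \<sqsubseteq> y" using j_le yc sc insert.prems by auto
    qed (use insert.prems sc j(1) in auto)
    then show ?case ..
  qed
  interpret join_semilattice M by unfold_locales (rule fin)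
  \<comment> \<open>Now that finite joins exist, antisymmetry identifies the chosen
    \<open>\<bottom>\<close> and \<open>\<squnion>\<close> with \<open>z\<close> and
    \<open>j\<close>.\<close>
  have "z \<sqsubseteq> \<bottom>" using z by (simp add: le)
  then have bot: "\<bottom> = z" using z(1) by (intro le_antisym) auto
  have join: "x \<squnion> y = j x y" if "x \<in> carrier M" "y \<in> carrier M" for x y
    using that by (intro eqI_upper) (auto simp: join_le_iff j_le j(1))
  show "distributive_module M"
  proof
    fix m n :: 'm and x y :: 'h
    assume c: "m \<in> carrier M" "n \<in> carrier M" and "x \<le> y" "m \<sqsubseteq> n"
    \<comment> \<open>Monotonicity is split at \<open>act M y m\<close>: \<open>x \<le> y\<close>
      means \<open>sup x y = y\<close>, and \<open>m \<sqsubseteq> n\<close> means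
      \<open>j m n = n\<close>, so the two distributive laws give the two halves.\<close>
    then have "j (act M x m) (act M y m) = act M y m" "j (act M y m) (act M y n) = act M y n"
      using act(5)[of m x y] act(6)[of m n y] by (simp_all add: sup_absorb2 le)
    then have "act M x m \<sqsubseteq> act M y m" "act M y m \<sqsubseteq> act M y n" using c act(1) by (simp_all add: le)
    then show "act M x m \<sqsubseteq> act M y n" by (rule le_trans) (use c act(1) in auto)
  qed (simp_all add: bot join act j(1))
  show "\<bottom> = z" by (rule bot)
  show "\<lbrakk>x \<in> carrier M; y \<in> carrier M\<rbrakk> \<Longrightarrow> x \<squnion> y = j x y" by (rule join)
qed

text \<open>The residual is the join of the finitely many solutions.\<close>

lemma heyting_module_of_finite:
  fixes M :: "('m, 'h::{heyting_algebra, finite}) lmodule" (structure)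
  assumes "distributive_module M"
  shows "heyting_module M"
proof -
  interpret distributive_module M by fact
  show ?thesis
  proof
    fix m n assume c: "m \<in> carrier M" "n \<in> carrier M"
    \<comment> \<open>An arbitrary set \<open>A\<close> of solutions permits induction on
      \<open>A\<close>: the witness grows to \<open>sup a w\<close>, which stays a solution by
      \<open>act_sup\<close>.\<close>
    have "\<exists>w. act M w m \<sqsubseteq> n \<and> (\<forall>x\<in>A. x \<le> w)" if "\<forall>x\<in>A. act M x m \<sqsubseteq> n" for A
      using finite[of A] that
    proof (induction A)
      case empty
      have "act M bot m \<sqsubseteq> n" using c by (simp add: act_bot)
      then show ?case by auto
    next
      case (insert a A)
      then obtain w where w: "act M w m \<sqsubseteq> n" "\<forall>x\<in>A. x \<le> w" by auto
      have "act M (sup a w) m \<sqsubseteq> n" using insert.prems w c by (simp add: act_sup join_le_iff act_closed)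
      with w show ?case by (intro exI[of _ "sup a w"]) (auto intro: le_supI2)
    qed
    from this[of "{x. act M x m \<sqsubseteq> n}"]
    obtain w where w: "act M w m \<sqsubseteq> n" "\<And>x. act M x m \<sqsubseteq> n \<Longrightarrow> x \<le> w" by auto
    \<comment> \<open>Solutions are closed downwards, so the largest one is a residual.\<close>
    have "act M x m \<sqsubseteq> n" if "x \<le> w" for x
      using act_mono[OF c(1) c(1) that] c w(1) by (meson act_closed le_trans local.le_refl)
    with w show "\<exists>w. \<forall>x. act M x m \<sqsubseteq> n \<longleftrightarrow> x \<le> w" by blast
  qed
qed

section \<open>Morphisms of modules\<close>

lemma module_homI:
  assumes "g \<in> carrier M \<rightarrow>\<^sub>E carrier N" "g \<bottom>\<^bsub>M\<^esub> = \<bottom>\<^bsub>N\<^esub>"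
    and "\<And>m n. \<lbrakk>m \<in> carrier M; n \<in> carrier M\<rbrakk> \<Longrightarrow> g (m \<squnion>\<^bsub>M\<^esub> n) = g m \<squnion>\<^bsub>N\<^esub> g n"
    and "\<And>x m. m \<in> carrier M \<Longrightarrow> g (act M x m) = act N x (g m)"
  shows "g \<in> module_hom M N"
  using assms by (simp add: module_hom_def)

lemma module_homD:
  assumes "g \<in> module_hom M N"
  shows "g \<in> carrier M \<rightarrow>\<^sub>E carrier N" "\<And>m. m \<in> carrier M \<Longrightarrow> g m \<in> carrier N"
    "g \<bottom>\<^bsub>M\<^esub> = \<bottom>\<^bsub>N\<^esub>"
    "\<And>m n. \<lbrakk>m \<in> carrier M; n \<in> carrier M\<rbrakk> \<Longrightarrow> g (m \<squnion>\<^bsub>M\<^esub> n) = g m \<squnion>\<^bsub>N\<^esub> g n"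
    "\<And>x m. m \<in> carrier M \<Longrightarrow> g (act M x m) = act N x (g m)"
proof -
  show g: "g \<in> carrier M \<rightarrow>\<^sub>E carrier N" using assms unfolding module_hom_def by blast
  show "\<And>m. m \<in> carrier M \<Longrightarrow> g m \<in> carrier N" by (rule PiE_mem[OF g])
qed (use assms in \<open>simp_all add: module_hom_def\<close>)

lemma (in distributive_module) module_id_hom: "module_id M \<in> module_hom M M"
  by (rule module_homI) (auto simp: module_id_def act_closed)

lemma module_hom_compose:
  assumes "distributive_module M" "g \<in> module_hom M N" "h \<in> module_hom N P"
  shows "compose (carrier M) h g \<in> module_hom M P"
proof -
  interpret distributive_module M by fact
  note g = module_homD[OF assms(2)] and h = module_homD[OF assms(3)]
  show ?thesis
    by (rule module_homI) (simp_all add: compose_def g(2-5) h(2-5) act_closed)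
qed


section \<open>Restriction of scalars\<close>

lemma restrict_scalars_simps [simp]:
  "carrier (restrict_scalars f N) = carrier N"
  "eq (restrict_scalars f N) = eq N"
  "le (restrict_scalars f N) = le N"
  "act (restrict_scalars f N) c = act N (f c)"
  by (simp_all add: restrict_scalars_def)

text \<open>Bottom and joins are chosen from the carrier and the order alone, and restriction
  changes only the action, so even the choices coincide.\<close>

lemma bottom_restrict_scalars [simp]: "\<bottom>\<^bsub>restrict_scalars f N\<^esub> = \<bottom>\<^bsub>N\<^esub>"
  by (simp add: bottom_def least_def)

lemma join_restrict_scalars [simp]: "x \<squnion>\<^bsub>restrict_scalars f N\<^esub> y = x \<squnion>\<^bsub>N\<^esub> y"
  by (simp add: join_def Lattice.sup_def least_def Upper_def)

lemma lattice_morphismD: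
  assumes "lattice_morphism f"
  shows "f bot = bot" "f top = top" "f (inf x y) = inf (f x) (f y)" "f (sup x y) = sup (f x) (f y)"
  using assms by (simp_all add: lattice_morphism_def)

text \<open>The laws are those of \<open>N\<close> at scalars of the form \<open>f c\<close>,
  because \<open>f\<close> preserves bounds, meets and joins.\<close>

lemma distributive_module_restrict_scalars:
  assumes "distributive_module N" "lattice_morphism f"
  shows "distributive_module (restrict_scalars f N)"
proof -
  interpret distributive_module N by fact
  note f = lattice_morphismD[OF assms(2)]
  show ?thesis
    by (rule distributive_moduleI[where j = "join N" and z = "bottom N"])
      (auto simp: f eq_is_equal act_closed act_top act_bot act_inf act_sup act_join
        join_assoc le_iff_join intro: join_comm)
qed

lemma module_hom_restrict_scalars:
  "g \<in> module_hom N N' \<Longrightarrow> g \<in> module_hom (restrict_scalars f N) (restrict_scalars f N')"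
  by (simp add: module_hom_def)

text \<open>Residuals over \<open>'h\<close> come from its finiteness; the functor laws are
  immediate because maps are left unchanged.\<close>

lemma heymod_functor_restrict_scalars:
  fixes f :: "'h::{heyting_algebra, finite} \<Rightarrow> 'k::heyting_algebra"
  assumes "lattice_morphism f"
  shows "heymod_functor (restrict_scalars f :: ('n, 'k) lmodule \<Rightarrow> _) restrict_scalars_map"
  using assms unfolding heymod_functor_def restrict_scalars_map_def
  by (auto simp: module_id_def module_hom_restrict_scalars
      intro!: heyting_module_of_finite distributive_module_restrict_scalars
      dest: heyting_module.axioms(1))

section \<open>A lattice as a module over itself\<close>

lemma
  shows distributive_module_lattice_module:
      "distributive_module (lattice_module ::
        ('k::{Lattices.bounded_lattice, Lattices.distrib_lattice}, 'k) lmodule)"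
    and bottom_lattice_module [simp]: "\<bottom>\<^bsub>lattice_module :: ('k, 'k) lmodule\<^esub> = bot"
    and join_lattice_module [simp]: "x \<squnion>\<^bsub>lattice_module :: ('k, 'k) lmodule\<^esub> y = sup x y"
proof -
  show "distributive_module (lattice_module :: ('k, 'k) lmodule)"
    by (rule distributive_moduleI[where j = sup and z = bot])
      (simp_all add: lattice_module_def sup.commute sup.left_commute inf.assoc inf_sup_distrib1
        inf_sup_distrib2 le_iff_sup)
  show "\<bottom>\<^bsub>lattice_module :: ('k, 'k) lmodule\<^esub> = bot"
    by (rule bottom_eqI[where j = sup and z = bot])
      (simp_all add: lattice_module_def sup.commute sup.left_commute inf.assoc inf_sup_distrib1
        inf_sup_distrib2 le_iff_sup)
  show "x \<squnion>\<^bsub>lattice_module :: ('k, 'k) lmodule\<^esub> y = sup x y"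
    by (rule join_eqI[where j = sup and z = bot])
      (simp_all add: lattice_module_def sup.commute sup.left_commute inf.assoc inf_sup_distrib1
        inf_sup_distrib2 le_iff_sup)
qed

lemma lattice_module_simps [simp]:
  "carrier lattice_module = UNIV" "act lattice_module = inf"
  by (simp_all add: lattice_module_def)

section \<open>Free modules\<close>

lemma free_carrier_iff:
  "u \<in> carrier (free_module S) \<longleftrightarrow> finite {s. u s \<noteq> bot} \<and> (\<forall>s. u s \<noteq> bot \<longrightarrow> s \<in> S)"
  by (auto simp: free_module_def)

lemma free_bot [simp]: "bot \<in> carrier (free_module S)"
  by (simp add: free_carrier_iff)

lemma free_sup [simp]:
  assumes "u \<in> carrier (free_module S)" "v \<in> carrier (free_module S)"
  shows "sup u v \<in> carrier (free_module S)"
  using assms by (auto simp: free_carrier_iff intro!: finite_subset[of _ "{s. u s \<noteq> bot} \<union> {s. v s \<noteq> bot}"])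

lemma free_gen_in [simp]: "s \<in> S \<Longrightarrow> free_gen c s \<in> carrier (free_module S)"
  by (auto simp: free_carrier_iff free_gen_def intro!: finite_subset[of _ "{s}"])

text \<open>Induction on the support, so that a claim about formal sums is checked one generator at
  a time.\<close>

lemma free_induct [consumes 1, case_names bot gen]:
  assumes u: "u \<in> carrier (free_module S)"
    and bot: "P bot"
    and step: "\<And>u c s. \<lbrakk>u \<in> carrier (free_module S); s \<in> S; P u\<rbrakk> \<Longrightarrow> P (sup u (free_gen c s))"
  shows "P u"
proof -
  have "P u" if "finite A" "{s. u s \<noteq> bot} = A" "A \<subseteq> S" for A u
    using that
  proof (induction A arbitrary: u)
    case empty
    then have "u = bot" by (auto simp: fun_eq_iff)
    with bot show ?case by (simp only:)
  next
    case (insert a A)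
    \<comment> \<open>Erasing the coefficient at \<open>a\<close> leaves the support
      \<open>A\<close>; joining the generator back restores \<open>u\<close>.\<close>
    define v where "v = u(a := bot)"
    have "{s. v s \<noteq> bot} = A" using insert by (auto simp: v_def)
    moreover have "sup v (free_gen (u a) a) = u" by (auto simp: v_def free_gen_def fun_eq_iff)
    ultimately show ?case using insert step[of v a "u a"] by (auto simp: free_carrier_iff)
  qed
  with u show ?thesis by (auto simp: free_carrier_iff)
qed

text \<open>Each coefficient is a finite supremum over a fibre. The inserted \<open>bot\<close>
  keeps it nonempty without changing the upper bounds, and points outside the support impose no
  condition.\<close>

lemma free_map_le_iff:
  assumes "finite {s. u s \<noteq> bot}"
  shows "free_map \<phi> u t \<le> y \<longleftrightarrow> (\<forall>s. \<phi> s = t \<longrightarrow> u s \<le> y)"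
proof -
  have "finite {s. u s \<noteq> bot \<and> \<phi> s = t}" by (rule finite_subset[OF _ assms]) auto
  then have "free_map \<phi> u t \<le> y \<longleftrightarrow> (\<forall>s. u s \<noteq> bot \<and> \<phi> s = t \<longrightarrow> u s \<le> y)"
    unfolding free_map_def by (subst Sup_fin.bounded_iff) auto
  also have "\<dots> \<longleftrightarrow> (\<forall>s. \<phi> s = t \<longrightarrow> u s \<le> y)" by (metis bot_least)
  finally show ?thesis .
qed

lemma free_map_cong: "(\<And>s. u s \<noteq> bot \<Longrightarrow> \<phi> s = \<psi> s) \<Longrightarrow> free_map \<phi> u = free_map \<psi> u"
  unfolding free_map_def by (intro ext arg_cong[where f = "\<lambda>A. Sup_fin (insert bot (u ` A))"]) auto

lemma free_map_carrier:
  assumes "u \<in> carrier (free_module S)" "\<And>s. s \<in> S \<Longrightarrow> \<phi> s \<in> T"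
  shows "free_map \<phi> u \<in> carrier (free_module T)"
proof -
  have fin: "finite {s. u s \<noteq> bot}" using assms by (simp add: free_carrier_iff)
  \<comment> \<open>For \<open>y = bot\<close> the criterion says that a coefficient vanishes as
    soon as all coefficients in its fibre do.\<close>
  have sub: "{t. free_map \<phi> u t \<noteq> bot} \<subseteq> \<phi> ` {s. u s \<noteq> bot}"
    using free_map_le_iff[OF fin, of \<phi> _ bot] by (auto simp: bot_unique image_iff)
  then have "{t. free_map \<phi> u t \<noteq> bot} \<subseteq> T" using assms by (auto simp: free_carrier_iff)
  with finite_surj[OF fin sub] show ?thesis by (auto simp: free_carrier_iff)
qed

text \<open>Pointwise counterpart of \<open>eqI_upper\<close>, which reduces identities of
  \<open>free_map\<close> to \<open>free_map_le_iff\<close>.\<close>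

lemma fun_eqI_upper:
  fixes u v :: "'s \<Rightarrow> 'h::order"
  assumes "\<And>t y. u t \<le> y \<longleftrightarrow> v t \<le> y"
  shows "u = v"
  using assms by (intro ext order.antisym) auto

lemma free_map_bot [simp]: "free_map \<phi> bot = bot"
  by (rule fun_eqI_upper) (simp add: free_map_le_iff)

lemma free_map_sup:
  assumes "u \<in> carrier (free_module S)" "v \<in> carrier (free_module S)"
  shows "free_map \<phi> (sup u v) = sup (free_map \<phi> u) (free_map \<phi> v)"
  using assms free_sup[OF assms]
  by (intro fun_eqI_upper) (auto simp: free_map_le_iff free_carrier_iff simp del: sup_eq_bot_iff)

lemma free_map_gen [simp]: "free_map \<phi> (free_gen c s) = free_gen c (\<phi> s)"
proof -
  have "finite {t. free_gen c s t \<noteq> bot}"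
    by (rule finite_subset[of _ "{s}"]) (auto simp: free_gen_def)
  then show ?thesis by (intro fun_eqI_upper) (auto simp: free_map_le_iff free_gen_def)
qed

lemma free_map_comp:
  assumes "u \<in> carrier (free_module S)"
  shows "free_map \<phi> (free_map \<psi> u) = free_map (\<lambda>s. \<phi> (\<psi> s)) u"
proof -
  have u: "finite {s. u s \<noteq> bot}" "finite {s. free_map \<psi> u s \<noteq> bot}"
    using assms free_map_carrier[of u S \<psi> UNIV] by (simp_all add: free_carrier_iff)
  then show ?thesis by (intro fun_eqI_upper) (auto simp: free_map_le_iff)
qed

lemma free_map_id:
  assumes "u \<in> carrier (free_module S)" "\<And>s. s \<in> S \<Longrightarrow> \<phi> s = s"
  shows "free_map \<phi> u = u"
proof -
  have "free_map \<phi> u = free_map (\<lambda>s. s) u"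
    using assms by (intro free_map_cong) (auto simp: free_carrier_iff)
  also have "\<dots> = u"
    using assms by (intro fun_eqI_upper) (auto simp: free_map_le_iff free_carrier_iff)
  finally show ?thesis .
qed

section \<open>Evaluation of formal sums in a module\<close>

text \<open>The semilinear extension of \<open>b\<close> along \<open>f\<close>, sending \<Sum> c_i
  \<and> s_i to the join of the f(c_i) \<and> b(s_i). Running over the support keeps the join
  finite.\<close>

definition free_eval ::
    "('h \<Rightarrow> 'k) \<Rightarrow> ('n, 'k) lmodule \<Rightarrow> ('s \<Rightarrow> 'n) \<Rightarrow> ('s \<Rightarrow> 'h::Lattices.bounded_lattice) \<Rightarrow> 'n" where
  "free_eval f N b u = \<Squnion>\<^bsub>N\<^esub>((\<lambda>s. act N (f (u s)) (b s)) ` {s. u s \<noteq> bot})"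

locale free_evaluation = distributive_module N
  for f :: "'h::{Lattices.bounded_lattice, Lattices.distrib_lattice} \<Rightarrow>
      'k::{Lattices.bounded_lattice, Lattices.distrib_lattice}"
    and N :: "('n, 'k) lmodule" (structure)
    and S :: "'s set"
    and b :: "'s \<Rightarrow> 'n" +
  assumes morphism: "lattice_morphism f"
    and b_closed: "s \<in> S \<Longrightarrow> b s \<in> carrier N"
begin

lemma free_eval_closed [simp]:
  assumes "u \<in> carrier (free_module S)"
  shows "free_eval f N b u \<in> carrier N"
proof -
  have "(\<lambda>s. act N (f (u s)) (b s)) ` {s. u s \<noteq> bot} \<subseteq> carrier N"
    using assms by (auto simp: free_carrier_iff b_closed act_closed)
  with assms show ?thesis
    unfolding free_eval_def by (intro least_closed[OF finite_Sup_least]) (auto simp: free_carrier_iff)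
qed

text \<open>A range of quantification that does not depend on \<open>u\<close> makes the evaluations
  of \<open>u\<close>, \<open>v\<close> and \<open>sup u v\<close> comparable term by term.\<close>

lemma free_eval_le_iff:
  assumes u: "u \<in> carrier (free_module S)" and y: "y \<in> carrier N"
  shows "free_eval f N b u \<sqsubseteq> y \<longleftrightarrow> (\<forall>s\<in>S. act N (f (u s)) (b s) \<sqsubseteq> y)"
proof -
  have "(\<lambda>s. act N (f (u s)) (b s)) ` {s. u s \<noteq> bot} \<subseteq> carrier N"
    using u by (auto simp: free_carrier_iff b_closed act_closed)
  then have "free_eval f N b u \<sqsubseteq> y \<longleftrightarrow> (\<forall>s\<in>{s. u s \<noteq> bot}. act N (f (u s)) (b s) \<sqsubseteq> y)"
    unfolding free_eval_def using u y by (subst finite_Sup_le_iff) (auto simp: free_carrier_iff)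
  also have "\<dots> \<longleftrightarrow> (\<forall>s\<in>S. act N (f (u s)) (b s) \<sqsubseteq> y)"
  proof -
    \<comment> \<open>Since \<open>f\<close> preserves \<open>bot\<close>, points of
      \<open>S\<close> outside the support contribute only \<open>\<bottom>\<close>.\<close>
    have "act N (f bot) (b s) \<sqsubseteq> y" if "s \<in> S" for s
      using that y by (simp add: lattice_morphismD[OF morphism] act_bot b_closed)
    with u show ?thesis by (metis (mono_tags, lifting) free_carrier_iff mem_Collect_eq)
  qed
  finally show ?thesis .
qed

lemma free_eval_bot: "free_eval f N b bot = \<bottom>"
  by (rule eqI_upper)
    (auto simp: free_eval_le_iff lattice_morphismD[OF morphism] act_bot b_closed)

lemma free_eval_sup:
  assumes "u \<in> carrier (free_module S)" "v \<in> carrier (free_module S)"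
  shows "free_eval f N b (sup u v) = free_eval f N b u \<squnion> free_eval f N b v"
  using assms
  by (intro eqI_upper)
    (auto simp: free_eval_le_iff lattice_morphismD[OF morphism] act_sup act_closed b_closed
      join_le_iff)

lemma free_eval_gen:
  assumes "s \<in> S"
  shows "free_eval f N b (free_gen c s) = act N (f c) (b s)"
proof (rule eqI_upper)
  fix y assume y: "y \<in> carrier N"
  then have "act N (f (free_gen c s t)) (b t) \<sqsubseteq> y" if "t \<in> S" "t \<noteq> s" for t
    using that by (simp add: free_gen_def lattice_morphismD[OF morphism] act_bot b_closed)
  moreover have "free_gen c s s = c" by (simp add: free_gen_def)
  ultimately show "free_eval f N b (free_gen c s) \<sqsubseteq> y \<longleftrightarrow> act N (f c) (b s) \<sqsubseteq> y"
    using y assms by (subst free_eval_le_iff) (auto, metis)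
qed (use assms in \<open>auto simp: act_closed b_closed\<close>)

end


section \<open>Tensor products\<close>

text \<open>The function arguments in the cases of \<open>tensor_eq.induct\<close> are eta-expanded, so these rules would
  push the operations of free module elements below the binder.\<close>

declare sup_apply [simp del] bot_apply [simp del]

locale tensor_product = M: distributive_module M + N: distributive_module N
  for M :: "('m, 'h::heyting_algebra) lmodule" and N :: "('n, 'h) lmodule"
begin

abbreviation free_carrier where
  "free_carrier \<equiv> carrier (free_module (carrier M \<times> carrier N))"

lemma tensor_eq_closed:
  assumes "tensor_eq M N u v" shows "u \<in> free_carrier \<and> v \<in> free_carrier"
  using assms by induction (simp_all add: M.act_closed N.act_closed)

text \<open>Every generating relation carries an arbitrary summand \<open>u\<close>, which absorbs
  \<open>w\<close>.\<close>

lemma tensor_eq_sup_right: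
  assumes "tensor_eq M N u v" "w \<in> free_carrier"
  shows "tensor_eq M N (sup u w) (sup v w)"
  using assms(1)
proof induction
  case (zero_left u n c)
  with assms(2) tensor_eq.zero_left[of "sup u w" M N n c] show ?case by (simp add: ac_simps)
next
  case (zero_right u m c)
  with assms(2) tensor_eq.zero_right[of "sup u w" M N m c] show ?case by (simp add: ac_simps)
next
  case (join_left u m m' n c)
  with assms(2) tensor_eq.join_left[of "sup u w" M N m m' n c] show ?case by (simp add: ac_simps)
next
  case (join_right u m n n' c)
  with assms(2) tensor_eq.join_right[of "sup u w" M N m n n' c] show ?case by (simp add: ac_simps)
next
  case (act_left u m n c d)
  with assms(2) tensor_eq.act_left[of "sup u w" M N m n c d] show ?case
    by (simp add: sup.assoc sup.commute sup.left_commute)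
next
  case (act_right u m n c d)
  with assms(2) tensor_eq.act_right[of "sup u w" M N m n c d] show ?case
    by (simp add: sup.assoc sup.commute sup.left_commute)
next
  case (refl u)
  with assms(2) show ?case by (simp add: tensor_eq.refl)
next
  case (sym u v)
  then show ?case by (blast intro: tensor_eq.sym)
next
  case (trans u v x)
  then show ?case by (blast intro: tensor_eq.trans)
qed

lemma tensor_eq_sup:
  assumes "tensor_eq M N u u'" "tensor_eq M N v v'"
  shows "tensor_eq M N (sup u v) (sup u' v')"
  \<comment> \<open>One summand is replaced at a time, passing through
    \<open>sup u' v\<close>.\<close>
  using tensor_eq_sup_right[OF assms(1), of v] tensor_eq_sup_right[OF assms(2), of u']
    tensor_eq_closed[OF assms(1)] tensor_eq_closed[OF assms(2)]
  by (simp add: sup.commute tensor_eq.trans)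

lemma tensor_class_eq_iff:
  assumes "u \<in> free_carrier"
  shows "tensor_class M N v = tensor_class M N u \<longleftrightarrow> tensor_eq M N v u"
  unfolding tensor_class_def using assms tensor_eq.refl[OF assms]
  by (auto intro: tensor_eq.sym tensor_eq.trans)

lemma mem_tensor_class: "v \<in> tensor_class M N u \<longleftrightarrow> tensor_eq M N u v"
  by (simp add: tensor_class_def)

text \<open>Operations on the quotient are unions over representatives. If the result does not
  depend on the representative, this is a nonempty union of equal sets.\<close>

lemma UN_tensor_class:
  assumes "u \<in> free_carrier" "\<And>v. tensor_eq M N u v \<Longrightarrow> q v = q u"
  shows "(\<Union>v\<in>tensor_class M N u. q v) = q u"
proof -
  have "tensor_class M N u \<noteq> {}"
    using tensor_eq.refl[OF assms(1)] mem_tensor_class by blast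
  moreover have "(\<Union>v\<in>tensor_class M N u. q v) = (\<Union>v\<in>tensor_class M N u. q u)"
    by (rule SUP_cong[OF HOL.refl]) (simp add: mem_tensor_class assms(2))
  ultimately show ?thesis by simp
qed

lemma tensor_join_class:
  assumes "u \<in> free_carrier" "v \<in> free_carrier"
  shows "tensor_join M N (tensor_class M N u) (tensor_class M N v) = tensor_class M N (sup u v)"
proof -
  have *: "tensor_class M N (sup u' v') = tensor_class M N (sup u v)"
    if "tensor_eq M N u u'" "tensor_eq M N v v'" for u' v'
  proof -
    have "tensor_eq M N (sup u' v') (sup u v)" by (intro tensor_eq_sup that[THEN tensor_eq.sym])
    then show ?thesis using assms by (simp add: tensor_class_eq_iff)
  qed
  have "(\<Union>v'\<in>tensor_class M N v. tensor_class M N (sup u' v')) = tensor_class M N (sup u v)"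
    if "tensor_eq M N u u'" for u'
    using UN_tensor_class[OF assms(2), of "\<lambda>v'. tensor_class M N (sup u' v')"]
      *[OF that] tensor_eq.refl[OF assms(2)] by simp
  then show ?thesis
    unfolding tensor_join_def using tensor_eq.refl[OF assms(1)]
    by (subst UN_tensor_class[OF assms(1)]) simp_all
qed

text \<open>Well-definedness of g \<otimes> k: morphisms carry each generating relation to one of
  the same kind. With \<open>g\<close> the identity this yields the action on the extension, with
  \<open>k\<close> the identity the extension of morphisms.\<close>

lemma tensor_eq_free_map:
  assumes g: "g \<in> module_hom M M'" and k: "k \<in> module_hom N N'" and "tensor_eq M N u v"
  defines "\<phi> \<equiv> \<lambda>(m, n). (g m, k n)"
  shows "tensor_eq M' N' (free_map \<phi> u) (free_map \<phi> v)"
proof -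
  note gD = module_homD(2-5)[OF g] and kD = module_homD(2-5)[OF k]
  have gen: "free_gen c (m, n) \<in> free_carrier" if "m \<in> carrier M" "n \<in> carrier N" for c m n
    using that by simp
  have cl: "free_map \<phi> u \<in> carrier (free_module (carrier M' \<times> carrier N'))"
    if "u \<in> free_carrier" for u
    by (rule free_map_carrier[OF that]) (auto simp: \<phi>_def gD kD)
  have \<phi>: "free_map \<phi> (sup u (free_gen c (m, n))) = sup (free_map \<phi> u) (free_gen c (g m, k n))"
    if "u \<in> free_carrier" "m \<in> carrier M" "n \<in> carrier N" for u c m n
    by (subst free_map_sup[OF that(1) gen[OF that(2,3)]]) (simp add: \<phi>_def)
  from assms(3) show ?thesis
  proof induction
    case (zero_left u n c)
    then show ?case using tensor_eq.zero_left[OF cl kD(1), of u n c] by (simp add: \<phi> gD)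
  next
    case (zero_right u m c)
    then show ?case using tensor_eq.zero_right[OF cl gD(1), of u m c] by (simp add: \<phi> kD)
  next
    case (join_left u m m' n c)
    then show ?case using tensor_eq.join_left[OF cl gD(1) gD(1) kD(1), of u m m' n c]
      by (simp add: \<phi> gD)
  next
    case (join_right u m n n' c)
    then show ?case using tensor_eq.join_right[OF cl gD(1) kD(1) kD(1), of u m n n' c]
      by (simp add: \<phi> kD)
  next
    case (act_left u m n c d)
    then show ?case using tensor_eq.act_left[OF cl gD(1) kD(1), of u m n c d]
      by (simp add: \<phi> gD M.act_closed)
  next
    case (act_right u m n c d)
    then show ?case using tensor_eq.act_right[OF cl gD(1) kD(1), of u m n c d]
      by (simp add: \<phi> kD N.act_closed)
  next
    case (refl u)
    then show ?case by (intro tensor_eq.refl cl)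
  next
    case (sym u v)
    then show ?case by (blast intro: tensor_eq.sym)
  next
    case (trans u v w)
    then show ?case by (blast intro: tensor_eq.trans)
  qed
qed

end

section \<open>Extension of scalars\<close>

locale scalar_extension = M: distributive_module M
  for f :: "'h::heyting_algebra \<Rightarrow> 'k::heyting_algebra" and M :: "('m, 'h) lmodule" +
  assumes morphism: "lattice_morphism f"
begin

abbreviation H' :: "('k, 'h) lmodule" where "H' \<equiv> restrict_scalars f lattice_module"

sublocale H': distributive_module H'
  by (rule distributive_module_restrict_scalars[OF distributive_module_lattice_module morphism])

sublocale T: tensor_product M H' ..

abbreviation E :: "(('m \<times> 'k \<Rightarrow> 'h) set, 'k) lmodule" where "E \<equiv> extend_scalars f M"

definition F :: "('m \<times> 'k \<Rightarrow> 'h) set" where "F = carrier (free_module (carrier M \<times> UNIV))"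

definition cls :: "('m \<times> 'k \<Rightarrow> 'h) \<Rightarrow> ('m \<times> 'k \<Rightarrow> 'h) set" where
  "cls = tensor_class M H'"

definition scale :: "'k \<Rightarrow> ('m \<times> 'k \<Rightarrow> 'h) \<Rightarrow> 'm \<times> 'k \<Rightarrow> 'h" where
  "scale x = free_map (\<lambda>(m, h). (m, inf h x))"

definition unit :: "'m \<Rightarrow> ('m \<times> 'k \<Rightarrow> 'h) set" where
  "unit m = cls (free_gen top (m, top))"

lemma F_intros [simp]:
  "bot \<in> F" "m \<in> carrier M \<Longrightarrow> free_gen c (m, h) \<in> F"
  "\<lbrakk>u \<in> F; v \<in> F\<rbrakk> \<Longrightarrow> sup u v \<in> F" "u \<in> F \<Longrightarrow> scale x u \<in> F"
  by (auto simp: F_def scale_def intro: free_map_carrier)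

lemma F_induct [consumes 1, case_names bot gen]:
  assumes "u \<in> F" "P bot"
    and "\<And>u c m h. \<lbrakk>u \<in> F; m \<in> carrier M; P u\<rbrakk> \<Longrightarrow> P (sup u (free_gen c (m, h)))"
  shows "P u"
  using assms(1) unfolding F_def
proof (induction rule: free_induct)
  case (gen u c s)
  then show ?case using assms(3)[of u "fst s" c "snd s"] by (auto simp: F_def)
qed (rule assms(2))

lemma scale_simps [simp]:
  "scale x bot = bot" "scale x (free_gen c (m, h)) = free_gen c (m, inf h x)"
  "\<lbrakk>u \<in> F; v \<in> F\<rbrakk> \<Longrightarrow> scale x (sup u v) = sup (scale x u) (scale x v)"
  by (simp_all add: scale_def F_def free_map_sup)

lemma F_free_carrier: "F = T.free_carrier"
  by (simp add: F_def)

lemma cls_eq_iff: "u \<in> F \<Longrightarrow> cls v = cls u \<longleftrightarrow> tensor_eq M H' v u"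
  unfolding cls_def F_free_carrier by (rule T.tensor_class_eq_iff)

lemma tensor_join_cls: "\<lbrakk>u \<in> F; v \<in> F\<rbrakk> \<Longrightarrow> tensor_join M H' (cls u) (cls v) = cls (sup u v)"
  unfolding cls_def F_free_carrier by (rule T.tensor_join_class)

lemma cls_sup_cong:
  assumes "u \<in> F" "v \<in> F" "u' \<in> F" "v' \<in> F" "cls u = cls u'" "cls v = cls v'"
  shows "cls (sup u v) = cls (sup u' v')"
  using assms tensor_join_cls[of u v] tensor_join_cls[of u' v'] by simp

text \<open>The generating relations with \<open>u = bot\<close>; inside longer sums they are
  applied through \<open>cls_sup_cong\<close>.\<close>

lemma cls_relations:
  assumes "m \<in> carrier M"
  shows "cls (free_gen c (\<bottom>\<^bsub>M\<^esub>, h)) = cls bot"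
    and "cls (free_gen c (m, bot)) = cls bot"
    and "m' \<in> carrier M \<Longrightarrow>
      cls (sup (free_gen c (m, h)) (free_gen c (m', h))) = cls (free_gen c (m \<squnion>\<^bsub>M\<^esub> m', h))"
    and "cls (sup (free_gen c (m, h)) (free_gen c (m, h'))) = cls (free_gen c (m, sup h h'))"
    and "cls (free_gen c (act M d m, h)) = cls (free_gen (inf c d) (m, h))"
    and "cls (free_gen (inf c d) (m, h)) = cls (free_gen c (m, inf (f d) h))"
  using assms tensor_eq.zero_left[of bot M H' h c] tensor_eq.zero_right[of bot M H' m c]
    tensor_eq.join_left[of bot M H' m m' h c] tensor_eq.join_right[of bot M H' m h h' c]
    tensor_eq.act_left[of bot M H' m h c d] tensor_eq.act_right[of bot M H' m h c d]
  by (simp_all add: cls_eq_iff M.act_closed)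

lemma carrier_E: "carrier E = cls ` F"
  by (simp add: extend_scalars_def tensor_def Let_def cls_def F_def)

lemma cls_in_E [simp]: "u \<in> F \<Longrightarrow> cls u \<in> carrier E"
  by (simp add: carrier_E)

text \<open>Meeting with \<open>x\<close> is an endomorphism of \<open>H'\<close> over
  \<open>'h\<close>, by distributivity and associativity, so this is an instance of
  \<open>tensor_eq_free_map\<close>.\<close>

lemma scale_tensor_eq:
  assumes "tensor_eq M H' u v" shows "tensor_eq M H' (scale x u) (scale x v)"
proof -
  have "(\<lambda>h. inf h x) \<in> module_hom H' H'"
    by (rule module_homI) (auto simp: inf_sup_distrib2 inf.assoc)
  note eq = T.tensor_eq_free_map[OF M.module_id_hom this assms]
  \<comment> \<open>\<open>module_id M\<close> is the identity only on the carrier, but this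
    contains all left entries in the support of \<open>w\<close>.\<close>
  have "scale x w = free_map (\<lambda>(m, h). (module_id M m, inf h x)) w" if "w \<in> T.free_carrier" for w
    unfolding scale_def using that
    by (intro free_map_cong) (auto simp: free_carrier_iff module_id_def)
  with eq T.tensor_eq_closed[OF assms] show ?thesis by simp
qed

lemma act_cls:
  assumes "u \<in> F"
  shows "act E x (cls u) = cls (scale x u)"
proof -
  have "act E x (cls u) = (\<Union>v\<in>tensor_class M H' u. cls (scale x v))"
    by (simp add: extend_scalars_def tensor_def Let_def cls_def scale_def)
  also have "\<dots> = cls (scale x u)"
  proof (rule T.UN_tensor_class)
    show "u \<in> T.free_carrier" using assms by (simp only: F_free_carrier)
    fix v assume "tensor_eq M H' u v"
    then have "tensor_eq M H' (scale x v) (scale x u)" by (rule scale_tensor_eq[OF tensor_eq.sym])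
    with assms show "cls (scale x v) = cls (scale x u)" by (simp add: cls_eq_iff)
  qed
  finally show ?thesis .
qed

lemma scale_scale: "u \<in> F \<Longrightarrow> scale x (scale y u) = scale (inf y x) u"
  unfolding scale_def F_def
  by (subst free_map_comp, assumption) (auto intro: free_map_cong simp: inf.assoc)

text \<open>Scaling by \<open>bot\<close> leaves generators of the form (m, 0), which vanish only
  modulo the zero relation on the right.\<close>

lemma cls_scale_bot:
  assumes "u \<in> F" shows "cls (scale bot u) = cls bot"
  using assms
proof (induction rule: F_induct)
  case (gen u c m h)
  then have "cls (sup (scale bot u) (free_gen c (m, bot))) = cls (sup bot bot)"
    by (intro cls_sup_cong) (simp_all add: cls_relations)
  with gen show ?case by simp
qed simp

text \<open>Distributivity in \<open>'k\<close> and the join relation on the right split each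
  generator in two; the summands are then regrouped.\<close>

lemma cls_scale_sup:
  assumes "u \<in> F" shows "cls (scale (sup x y) u) = cls (sup (scale x u) (scale y u))"
  using assms
proof (induction rule: F_induct)
  case (gen u c m h)
  have "cls (sup (scale (sup x y) u) (free_gen c (m, inf h (sup x y)))) =
    cls (sup (sup (scale x u) (scale y u)) (sup (free_gen c (m, inf h x)) (free_gen c (m, inf h y))))"
    using gen by (intro cls_sup_cong) (simp_all add: cls_relations inf_sup_distrib1)
  with gen show ?case by (simp add: sup.assoc sup.commute sup.left_commute)
qed simp

text \<open>The action laws at \<open>bot\<close> and \<open>sup\<close> are the two preceding
  lemmas; the remaining laws hold already for representatives.\<close>

lemma
  shows distributive_module_E: "distributive_module E"
    and bottom_E: "\<bottom>\<^bsub>E\<^esub> = cls bot"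
    and join_E: "\<lbrakk>X \<in> carrier E; Y \<in> carrier E\<rbrakk> \<Longrightarrow> X \<squnion>\<^bsub>E\<^esub> Y = tensor_join M H' X Y"
proof -
  have eq: "eq E = (=)" and le: "le E = (\<lambda>X Y. tensor_join M H' X Y = Y)"
    by (simp_all add: extend_scalars_def tensor_def Let_def)
  have top: "scale top u = u" if "u \<in> F" for u
    using that unfolding scale_def F_def by (rule free_map_id) auto
  note facts = carrier_E eq le tensor_join_cls act_cls scale_scale cls_scale_bot cls_scale_sup top
    sup.assoc sup.commute sup.left_commute inf.commute
  show "distributive_module E"
    by (rule distributive_moduleI[where j = "tensor_join M H'" and z = "cls bot"])
      (auto simp: facts)
  show "\<bottom>\<^bsub>E\<^esub> = cls bot"
    by (rule bottom_eqI[where j = "tensor_join M H'" and z = "cls bot"])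
      (auto simp: facts)
  show "\<lbrakk>X \<in> carrier E; Y \<in> carrier E\<rbrakk> \<Longrightarrow> X \<squnion>\<^bsub>E\<^esub> Y = tensor_join M H' X Y"
    by (rule join_eqI[where j = "tensor_join M H'" and z = "cls bot"])
      (auto simp: facts)
qed

sublocale E: distributive_module E
  by (rule distributive_module_E)

lemma join_cls: "\<lbrakk>u \<in> F; v \<in> F\<rbrakk> \<Longrightarrow> cls u \<squnion>\<^bsub>E\<^esub> cls v = cls (sup u v)"
  by (simp add: join_E tensor_join_cls)

section \<open>The unit and its universal property\<close>

lemma unit_closed [simp]: "m \<in> carrier M \<Longrightarrow> unit m \<in> carrier E"
  by (simp add: unit_def)

text \<open>Written as \<open>inf top c\<close>, the coefficient crosses into the right factor as
  \<open>f c\<close>, and the whole right entry is then a scalar acting on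
  \<open>top\<close>.\<close>

lemma cls_gen: "m \<in> carrier M \<Longrightarrow> cls (free_gen c (m, h)) = act E (inf (f c) h) (unit m)"
  using cls_relations(6)[of m top c h] by (simp add: unit_def act_cls)

lemma unit_hom: "(\<lambda>m\<in>carrier M. unit m) \<in> module_hom M (restrict_scalars f E)"
proof (rule module_homI)
  show "(\<lambda>m\<in>carrier M. unit m) \<bottom>\<^bsub>M\<^esub> = \<bottom>\<^bsub>restrict_scalars f E\<^esub>"
    using cls_relations(1)[of "\<bottom>\<^bsub>M\<^esub>" top top] by (simp add: bottom_E unit_def)
next
  fix m n assume "m \<in> carrier M" "n \<in> carrier M"
  then show "(\<lambda>m\<in>carrier M. unit m) (m \<squnion>\<^bsub>M\<^esub> n) =
      (\<lambda>m\<in>carrier M. unit m) m \<squnion>\<^bsub>restrict_scalars f E\<^esub> (\<lambda>m\<in>carrier M. unit m) n"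
    by (simp add: unit_def join_cls cls_relations)
next
  \<comment> \<open>The scalar moves from \<open>m\<close> into the coefficient, and by
    \<open>cls_gen\<close> from there to the action of \<open>f x\<close>.\<close>
  fix x m assume "m \<in> carrier M"
  then show "(\<lambda>m\<in>carrier M. unit m) (act M x m) =
      act (restrict_scalars f E) x ((\<lambda>m\<in>carrier M. unit m) m)"
    using cls_relations(5)[of m top x top] cls_gen[of m x top] by (simp add: unit_def M.act_closed)
qed auto

text \<open>By \<open>cls_gen\<close> every element is a finite join of multiples of units. Besides
  injectivity of the adjunction this gives the functor laws.\<close>

lemma hom_eqI:
  assumes \<phi>: "\<phi> \<in> module_hom E N" and \<phi>': "\<phi>' \<in> module_hom E N"
    and eq: "\<And>m. m \<in> carrier M \<Longrightarrow> \<phi> (unit m) = \<phi>' (unit m)"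
  shows "\<phi> = \<phi>'"
proof (rule PiE_ext[OF module_homD(1)[OF \<phi>] module_homD(1)[OF \<phi>']])
  fix X assume "X \<in> carrier E"
  then obtain u where X: "X = cls u" and "u \<in> F" by (auto simp: carrier_E)
  from this(2) show "\<phi> X = \<phi>' X" unfolding X
  proof (induction rule: F_induct)
    case bot
    then show ?case using module_homD(3)[OF \<phi>] module_homD(3)[OF \<phi>'] by (simp add: bottom_E)
  next
    case (gen u c m h)
    have "cls (sup u (free_gen c (m, h))) = cls u \<squnion>\<^bsub>E\<^esub> act E (inf (f c) h) (unit m)"
      using gen by (simp add: join_cls flip: cls_gen)
    with gen show ?case
      by (simp add: module_homD(4,5)[OF \<phi>] module_homD(4,5)[OF \<phi>'] eq E.act_closed)
  qed
qed

lemma extend_hom: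
  assumes N: "distributive_module N" and \<psi>: "\<psi> \<in> module_hom M (restrict_scalars f N)"
  obtains \<phi> where "\<phi> \<in> module_hom E N" "\<And>m. m \<in> carrier M \<Longrightarrow> \<phi> (unit m) = \<psi> m"
proof -
  interpret N: distributive_module N by (rule N)
  note \<psi>D = module_homD(2-5)[OF \<psi>, simplified]
  \<comment> \<open>Evaluating along \<open>f\<close> with these values at the generators gives the
    join of the (f(c_i) \<and> h_i) \<and> \<psi>(m_i).\<close>
  define b where "b = (\<lambda>(m, h). act N h (\<psi> m))"
  interpret free_evaluation f N "carrier M \<times> UNIV" b
    by unfold_locales (auto simp: morphism b_def \<psi>D N.act_closed)
  define ev where "ev = free_eval f N b"
  have ev_closed: "ev u \<in> carrier N" if "u \<in> F" for u
    using that by (simp add: ev_def F_def)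
  have ev_bot: "ev bot = \<bottom>\<^bsub>N\<^esub>"
    by (simp add: ev_def free_eval_bot)
  have ev_sup: "ev (sup u v) = ev u \<squnion>\<^bsub>N\<^esub> ev v" if "u \<in> F" "v \<in> F" for u v
    using that by (simp add: ev_def F_def free_eval_sup)
  have ev_gen: "ev (free_gen c (m, h)) = act N (inf (f c) h) (\<psi> m)" if "m \<in> carrier M" for c m h
    unfolding ev_def using that
    by (subst free_eval_gen) (simp_all add: b_def N.act_inf \<psi>D)
  \<comment> \<open>The bottom element equals 0 \<and> \<bottom>, and x \<and> 0 = 0 in the
    lattice.\<close>
  have act_bottom: "act N x \<bottom>\<^bsub>N\<^esub> = \<bottom>\<^bsub>N\<^esub>" for x
    using N.act_inf[of "\<bottom>\<^bsub>N\<^esub>" x bot] by (simp add: N.act_bot)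
  \<comment> \<open>Zero and join relations on the left hold since \<psi> and the action preserve
    finite joins, those on the right since the action does so in its scalar. The action relations
    compare meets of scalars.\<close>
  have ev_eq: "ev u = ev v" if "tensor_eq M H' u v" for u v
    using that
  proof induction
    case (zero_left u n c)
    then show ?case
      by (simp add: ev_sup ev_gen ev_closed \<psi>D act_bottom flip: F_def)
  next
    case (zero_right u m c)
    then show ?case
      by (simp add: ev_sup ev_gen ev_closed \<psi>D N.act_bot flip: F_def)
  next
    case (join_left u m m' n c)
    then show ?case
      by (simp add: ev_sup ev_gen ev_closed \<psi>D N.act_closed N.act_join N.join_assoc flip: F_def)
  next
    case (join_right u m n n' c)
    then show ?case
      by (simp add: ev_sup ev_gen ev_closed \<psi>D N.act_closed N.act_sup inf_sup_distrib1 N.join_assoc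
          flip: F_def)
  next
    case (act_left u m n c d)
    then show ?case
      by (simp add: ev_sup ev_gen \<psi>D M.act_closed lattice_morphismD[OF morphism] ac_simps
          flip: F_def N.act_inf)
  next
    case (act_right u m n c d)
    then show ?case
      by (simp add: ev_sup ev_gen lattice_morphismD[OF morphism] inf.assoc flip: F_def)
  qed simp_all
  \<comment> \<open>By \<open>ev_eq\<close> the image of a class under \<open>ev\<close> is a
    singleton, whose element is the value.\<close>
  define \<phi> where "\<phi> = (\<lambda>X\<in>carrier E. the_elem (ev ` X))"
  have \<phi>: "\<phi> (cls u) = ev u" if u: "u \<in> F" for u
  proof -
    have "u \<in> cls u" using tensor_eq.refl[of u M H'] u by (simp add: cls_def tensor_class_def F_def)
    moreover have "ev v = ev u" if "v \<in> cls u" for v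
      using that by (intro ev_eq[symmetric]) (simp add: cls_def tensor_class_def)
    ultimately have "ev ` cls u = {ev u}" by blast
    with u show ?thesis by (simp add: \<phi>_def)
  qed
  have ev_scale: "ev (scale x u) = act N x (ev u)" if "u \<in> F" for x u
    using that
  proof (induction rule: F_induct)
    case bot
    then show ?case by (simp add: ev_bot act_bottom)
  next
    case (gen u c m h)
    then show ?case
      by (simp add: ev_sup ev_gen ev_closed \<psi>D N.act_closed N.act_join ac_simps flip: N.act_inf)
  qed
  have "\<phi> \<in> module_hom E N"
  proof (rule module_homI)
    show "\<phi> \<in> carrier E \<rightarrow>\<^sub>E carrier N"
      by (rule PiE_I) (auto simp: carrier_E \<phi> ev_closed, simp add: \<phi>_def carrier_E)
    show "\<phi> \<bottom>\<^bsub>E\<^esub> = \<bottom>\<^bsub>N\<^esub>" by (simp add: bottom_E \<phi> ev_bot)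
    show "\<phi> (X \<squnion>\<^bsub>E\<^esub> Y) = \<phi> X \<squnion>\<^bsub>N\<^esub> \<phi> Y" if "X \<in> carrier E" "Y \<in> carrier E" for X Y
      using that by (auto simp: carrier_E join_cls \<phi> ev_sup)
    show "\<phi> (act E x X) = act N x (\<phi> X)" if "X \<in> carrier E" for x X
      using that by (auto simp: carrier_E act_cls \<phi> ev_scale)
  qed
  moreover have "\<phi> (unit m) = \<psi> m" if "m \<in> carrier M" for m
    using that by (simp add: unit_def \<phi> ev_gen lattice_morphismD[OF morphism] \<psi>D N.act_top)
  ultimately show ?thesis by (rule that)
qed

text \<open>Injectivity is \<open>hom_eqI\<close> and surjectivity is
  \<open>extend_hom\<close>.\<close>

lemma bij_betw_hom:
  assumes "distributive_module N"
  shows "bij_betw (\<lambda>\<phi>. \<lambda>m\<in>carrier M. \<phi> (unit m))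
    (module_hom E N) (module_hom M (restrict_scalars f N))"
proof (rule bij_betwI')
  fix \<phi> \<phi>' assume "\<phi> \<in> module_hom E N" "\<phi>' \<in> module_hom E N"
  then show "(\<lambda>m\<in>carrier M. \<phi> (unit m)) = (\<lambda>m\<in>carrier M. \<phi>' (unit m)) \<longleftrightarrow> \<phi> = \<phi>'"
    by (metis (no_types, lifting) hom_eqI restrict_apply')
next
  fix \<phi> assume "\<phi> \<in> module_hom E N"
  \<comment> \<open>Precomposing with the unit, itself a morphism into the restricted module, yields
    a morphism.\<close>
  then have "compose (carrier M) \<phi> (\<lambda>m\<in>carrier M. unit m) \<in> module_hom M (restrict_scalars f N)"
    by (rule module_hom_compose[OF M.distributive_module_axioms unit_hom
          module_hom_restrict_scalars])
  moreover have "compose (carrier M) \<phi> (\<lambda>m\<in>carrier M. unit m) = (\<lambda>m\<in>carrier M. \<phi> (unit m))"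
    by (auto simp: compose_def)
  ultimately show "(\<lambda>m\<in>carrier M. \<phi> (unit m)) \<in> module_hom M (restrict_scalars f N)" by simp
next
  fix \<psi> assume \<psi>: "\<psi> \<in> module_hom M (restrict_scalars f N)"
  then obtain \<phi> where "\<phi> \<in> module_hom E N" "\<And>m. m \<in> carrier M \<Longrightarrow> \<phi> (unit m) = \<psi> m"
    using extend_hom[OF assms \<psi>] by blast
  moreover from this(2) have "\<psi> = (\<lambda>m\<in>carrier M. \<phi> (unit m))"
    using module_homD(1)[OF \<psi>] by (intro ext) (auto simp: PiE_def extensional_def)
  ultimately show "\<exists>\<phi>\<in>module_hom E N. \<psi> = (\<lambda>m\<in>carrier M. \<phi> (unit m))" by auto
qed

end

section \<open>Functoriality of the extension of scalars\<close>

locale scalar_extension_map = M: scalar_extension f M + M': scalar_extension f M'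
  for f :: "'h::heyting_algebra \<Rightarrow> 'k::heyting_algebra" and M M' :: "('m, 'h) lmodule" +
  fixes g :: "'m \<Rightarrow> 'm"
  assumes g: "g \<in> module_hom M M'"
begin

definition free_g :: "('m \<times> 'k \<Rightarrow> 'h) \<Rightarrow> 'm \<times> 'k \<Rightarrow> 'h" where
  "free_g = free_map (\<lambda>(m, h). (g m, h))"

lemma free_g_closed [simp]: "u \<in> M.F \<Longrightarrow> free_g u \<in> M'.F"
  unfolding free_g_def M.F_def M'.F_def
  by (erule free_map_carrier) (auto simp: module_homD(2)[OF g])

lemma free_g_simps [simp]:
  "free_g bot = bot" "free_g (free_gen c (m, h)) = free_gen c (g m, h)"
  "\<lbrakk>u \<in> M.F; v \<in> M.F\<rbrakk> \<Longrightarrow> free_g (sup u v) = sup (free_g u) (free_g v)"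
  by (simp_all add: free_g_def M.F_def free_map_sup)

lemma free_g_tensor_eq:
  assumes "tensor_eq M M.H' u v" shows "tensor_eq M' M'.H' (free_g u) (free_g v)"
  using M.T.tensor_eq_free_map[OF g M.H'.module_id_hom assms]
  by (simp add: free_g_def module_id_def)

lemma map_cls:
  assumes "u \<in> M.F"
  shows "extend_scalars_map f M M' g (M.cls u) = M'.cls (free_g u)"
proof -
  have "extend_scalars_map f M M' g (M.cls u) = (\<Union>v\<in>tensor_class M M.H' u. M'.cls (free_g v))"
    using M.cls_in_E[OF assms]
    by (simp add: extend_scalars_map_def M.cls_def M'.cls_def free_g_def)
  also have "\<dots> = M'.cls (free_g u)"
  proof (rule M.T.UN_tensor_class)
    show "u \<in> M.T.free_carrier" using assms by (simp only: M.F_free_carrier)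
    fix v assume "tensor_eq M M.H' u v"
    then have "tensor_eq M' M'.H' (free_g v) (free_g u)"
      by (rule free_g_tensor_eq[OF tensor_eq.sym])
    with assms show "M'.cls (free_g v) = M'.cls (free_g u)" by (simp add: M'.cls_eq_iff)
  qed
  finally show ?thesis .
qed

lemma map_hom: "extend_scalars_map f M M' g \<in> module_hom M.E M'.E"
proof (rule module_homI)
  show "extend_scalars_map f M M' g \<in> carrier M.E \<rightarrow>\<^sub>E carrier M'.E"
  proof (rule PiE_I)
    show "extend_scalars_map f M M' g X \<in> carrier M'.E" if "X \<in> carrier M.E" for X
      using that by (auto simp: M.carrier_E map_cls)
  qed (simp add: extend_scalars_map_def)
  show "extend_scalars_map f M M' g \<bottom>\<^bsub>M.E\<^esub> = \<bottom>\<^bsub>M'.E\<^esub>"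
    by (simp add: M.bottom_E M'.bottom_E map_cls)
  show "extend_scalars_map f M M' g (X \<squnion>\<^bsub>M.E\<^esub> Y) =
      extend_scalars_map f M M' g X \<squnion>\<^bsub>M'.E\<^esub> extend_scalars_map f M M' g Y"
    if "X \<in> carrier M.E" "Y \<in> carrier M.E" for X Y
    using that by (auto simp: M.carrier_E M.join_cls M'.join_cls map_cls)
  \<comment> \<open>\<open>free_g\<close> changes left entries and \<open>scale\<close> right
    entries, so they commute.\<close>
  have "free_g (M.scale x u) = M'.scale x (free_g u)" if "u \<in> M.F" for x u
    using that by (induction rule: M.F_induct) (simp_all add: module_homD(2)[OF g])
  then show "extend_scalars_map f M M' g (act M.E x X) =
      act M'.E x (extend_scalars_map f M M' g X)" if "X \<in> carrier M.E" for x X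
    using that by (auto simp: M.carrier_E M.act_cls M'.act_cls map_cls)
qed

text \<open>Naturality of the unit, on which the functor laws and the naturality of the adjunction
  rest.\<close>

lemma map_unit: "m \<in> carrier M \<Longrightarrow> extend_scalars_map f M M' g (M.unit m) = M'.unit (g m)"
  by (simp add: M.unit_def M'.unit_def map_cls)

end

text \<open>Both functor laws equate morphisms out of an extension, so they are compared on units by
  \<open>hom_eqI\<close> and computed there by \<open>map_unit\<close>. Residuals come from
  finiteness of \<open>'k\<close>.\<close>

lemma heymod_functor_extend_scalars:
  fixes f :: "'h::heyting_algebra \<Rightarrow> 'k::{heyting_algebra, finite}"
  assumes f: "lattice_morphism f"
  shows "heymod_functor (extend_scalars f :: ('m, 'h) lmodule \<Rightarrow> _) (extend_scalars_map f)"
proof -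
  have ext: "scalar_extension f M" if "heyting_module M" for M :: "('m, 'h) lmodule"
    using that f by (simp add: scalar_extension_def scalar_extension_axioms_def heyting_module_def)
  have ext_map: "scalar_extension_map f M M' g"
    if "heyting_module M" "heyting_module M'" "g \<in> module_hom M M'"
    for M M' :: "('m, 'h) lmodule" and g
    using that by (simp add: scalar_extension_map_def scalar_extension_map_axioms_def ext)
  show ?thesis
    unfolding heymod_functor_def
  proof (intro conjI allI impI; (elim conjE)?)
    fix M :: "('m, 'h) lmodule" assume M: "heyting_module M"
    interpret scalar_extension f M by (rule ext[OF M])
    show "heyting_module E" by (rule heyting_module_of_finite[OF distributive_module_E])
    interpret scalar_extension_map f M M "module_id M"
      by (rule ext_map[OF M M M.module_id_hom])
    show "extend_scalars_map f M M (module_id M) = module_id E"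
    proof (rule hom_eqI[OF map_hom E.module_id_hom])
      fix m assume m: "m \<in> carrier M"
      then have "module_id M m = m" "module_id E (unit m) = unit m" by (simp_all add: module_id_def)
      with m show "extend_scalars_map f M M (module_id M) (unit m) = module_id E (unit m)"
        by (simp add: map_unit)
    qed
  next
    fix M N :: "('m, 'h) lmodule" and g
    assume "heyting_module M" "heyting_module N" "g \<in> module_hom M N"
    then show "extend_scalars_map f M N g \<in> module_hom (extend_scalars f M) (extend_scalars f N)"
      by (rule scalar_extension_map.map_hom[OF ext_map])
  next
    fix M N P :: "('m, 'h) lmodule" and g h
    assume M: "heyting_module M" and N: "heyting_module N" and P: "heyting_module P"
      and g: "g \<in> module_hom M N" and h: "h \<in> module_hom N P"
    interpret M: scalar_extension f M by (rule ext[OF M])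
    have hg: "compose (carrier M) h g \<in> module_hom M P"
      by (rule module_hom_compose[OF M.M.distributive_module_axioms g h])
    interpret g: scalar_extension_map f M N g by (rule ext_map[OF M N g])
    interpret h: scalar_extension_map f N P h by (rule ext_map[OF N P h])
    interpret hg: scalar_extension_map f M P "compose (carrier M) h g" by (rule ext_map[OF M P hg])
    show "extend_scalars_map f M P (compose (carrier M) h g) =
      compose (carrier (extend_scalars f M)) (extend_scalars_map f N P h) (extend_scalars_map f M N g)"
    proof (rule M.hom_eqI[OF hg.map_hom
          module_hom_compose[OF M.distributive_module_E g.map_hom h.map_hom]])
      fix m assume "m \<in> carrier M"
      then show "extend_scalars_map f M P (compose (carrier M) h g) (M.unit m) =
          compose (carrier M.E) (extend_scalars_map f N P h) (extend_scalars_map f M N g) (M.unit m)"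
        by (simp add: hg.map_unit g.map_unit h.map_unit compose_eq module_homD(2)[OF g])
    qed
  qed
qed

section \<open>The adjunction\<close>

theorem proposition6p7:
  fixes f :: "'h::{heyting_algebra, finite} \<Rightarrow> 'k::{heyting_algebra, finite}"
  assumes "lattice_morphism f"
  shows "heymod_left_adjoint
    (extend_scalars f :: ('m, 'h) lmodule \<Rightarrow> (('m \<times> 'k \<Rightarrow> 'h) set, 'k) lmodule)
    (extend_scalars_map f)
    (restrict_scalars f :: ('n, 'k) lmodule \<Rightarrow> ('n, 'h) lmodule)
    restrict_scalars_map"
  unfolding heymod_left_adjoint_def
proof (intro conjI exI allI impI; (elim conjE)?)
  show "heymod_functor (extend_scalars f :: ('m, 'h) lmodule \<Rightarrow> _) (extend_scalars_map f)"
    by (rule heymod_functor_extend_scalars[OF assms])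
  show "heymod_functor (restrict_scalars f :: ('n, 'k) lmodule \<Rightarrow> _) restrict_scalars_map"
    by (rule heymod_functor_restrict_scalars[OF assms])
  have ext: "scalar_extension f M" if "heyting_module M" for M :: "('m, 'h) lmodule"
    using that assms
    by (simp add: scalar_extension_def scalar_extension_axioms_def heyting_module_def)
  \<comment> \<open>The adjunction bijection is precomposition with the unit.\<close>
  let ?\<Phi> = "\<lambda>(M :: ('m, 'h) lmodule) (N :: ('n, 'k) lmodule) \<phi>.
    \<lambda>m\<in>carrier M. \<phi> (scalar_extension.unit f M m)"
  {
    fix M :: "('m, 'h) lmodule" and N :: "('n, 'k) lmodule"
    assume "heyting_module M" "heyting_module N"
    then show "bij_betw (?\<Phi> M N) (module_hom (extend_scalars f M) N)
        (module_hom M (restrict_scalars f N))"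
      by (intro scalar_extension.bij_betw_hom ext) (simp_all add: heyting_module_def)
  next
    fix M M' :: "('m, 'h) lmodule" and N N' :: "('n, 'k) lmodule" and g k \<phi>
    assume M: "heyting_module M" and M': "heyting_module M'"
      and g: "g \<in> module_hom M' M"
    interpret M: scalar_extension f M by (rule ext[OF M])
    interpret M': scalar_extension f M' by (rule ext[OF M'])
    interpret scalar_extension_map f M' M g by unfold_locales (rule g)
    \<comment> \<open>At \<open>m\<close> in \<open>carrier M'\<close>, both sides evaluate to
      \<open>k (\<phi> (M.unit (g m)))\<close>.\<close>
    show "?\<Phi> M' N' (compose (carrier M'.E) k (compose (carrier M'.E) \<phi> (extend_scalars_map f M' M g))) =
      compose (carrier M') (restrict_scalars_map N N' k) (compose (carrier M') (?\<Phi> M N \<phi>) g)"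
      by (auto simp: restrict_scalars_map_def compose_def map_unit module_homD(2)[OF g])
  }
qed

end
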